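(* Let $\omega$ and $n$ be positive integers and let $\mathbb{Z}_\omega$ be the cyclic group of order $\omega$. Suppose that $A=[0,n-3]\cup\{i,j\}$ is a subset of $\mathbb{Z}_\omega$ with $|A|=n\ge 5$. If $A$ is a direct factor of $\mathbb{Z}_\omega$, then $\{i,j\}\equiv\{n-2,n-1\}\pmod n$.
   Context: For an additively written finite abelian group $G$ and nonempty subsets $A,B\subseteq G$, we say that $G=A+B$ is a factorization if every $g\in G$ can be written in exactly one way as $g=a+b$ with $a\in A$, $b\in B$. A subset $A$ is a direct factor of $G$ if there is a subset $B\subseteq G$ such that $G=A+B$ is a factorization. For integers $a\le b$, $[a,b]=\{x\in\mathbb{Z}: a\le x\le b\}$, viewed in $\mathbb{Z}_\omega$ via reduction modulo $\omega$. If $A$ is a direct factor then $n=|A|$ divides $\omega$, so residues modulo $n$ of elements of $\mathbb{Z}_\omega$ are well defined; for sets $X,Y$, the notation $X\equiv Y\pmod n$ means that $X$ and $Y$ have the same set of residues modulo $n$. *)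

theory Defs
  imports "HOL-Algebra.Elementary_Groups"
begin

(* The abelian group is a HOL-Algebra structure, so the sum a + b of the mathematics is written
   a \<otimes> b; for the cyclic group integer_mod_group \<omega> it is addition modulo \<omega>. *)

definition factorization :: "('a, 'b) monoid_scheme \<Rightarrow> 'a set \<Rightarrow> 'a set \<Rightarrow> bool"
  where "factorization G A B \<longleftrightarrow>
    A \<subseteq> carrier G \<and> A \<noteq> {} \<and> B \<subseteq> carrier G \<and> B \<noteq> {} \<and>
    (\<forall>g \<in> carrier G. \<exists>!(a, b). a \<in> A \<and> b \<in> B \<and> g = a \<otimes>\<^bsub>G\<^esub> b)"

definition direct_factor :: "('a, 'b) monoid_scheme \<Rightarrow> 'a set \<Rightarrow> bool"
  where "direct_factor G A \<longleftrightarrow> (\<exists>B \<subseteq> carrier G. factorization G A B)"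

(* [a, b] viewed in the cyclic group of order \<omega>, whose carrier is {0..<\<omega>} *)
definition interval_mod :: "nat \<Rightarrow> int \<Rightarrow> int \<Rightarrow> int set"
  where "interval_mod \<omega> a b = (\<lambda>x. x mod int \<omega>) ` {a..b}"

(* Elements of the cyclic group of order \<omega> enter through their representatives in {0..<\<omega>}.
   When n divides \<omega>, their residues modulo n do not depend on that choice, because then
   (x mod \<omega>) mod n = x mod n (mod_mod_cancel). *)
definition set_cong :: "nat \<Rightarrow> int set \<Rightarrow> int set \<Rightarrow> bool"
  where "set_cong n X Y \<longleftrightarrow> (\<lambda>x. x mod int n) ` X = (\<lambda>y. y mod int n) ` Y"

end

theory Submission
  imports Defs
begin

text \<open>
  Let \<open>A + B\<close> be a factorization. Three consecutive elements cannot all lie in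
  \<open>(i + B) \<union> (j + B)\<close>: two of them would lie in the same translate, so two elements of \<open>B\<close>
  would differ by \<open>1\<close> or \<open>2\<close>, although \<open>{0, 1, 2} \<subseteq> A\<close>. So one of \<open>x - 2\<close>, \<open>x - 1\<close>, \<open>x\<close> lies in
  \<open>[0, n-3] + B\<close>, whence \<open>[0, n-1] + B\<close> is the whole group; by counting, it is a factorization too.
  This forces \<open>B + n \<subseteq> B\<close>, and then two elements of \<open>A\<close> congruent modulo \<open>n\<close> coincide.
\<close>

text \<open>Bijectivity gives access to both uses of a factorization: injectivity on
  \<open>A \<times> B\<close> and the count |A| |B| = \<omega>.\<close>

lemma bij_betw_factorization:
  assumes "\<omega> > 0" and "factorization (integer_mod_group \<omega>) A B"
  shows "bij_betw (\<lambda>(a, b). (a + b) mod int \<omega>) (A \<times> B) {0..<int \<omega>}"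
proof -
  have ex1: "\<exists>!(a, b). a \<in> A \<and> b \<in> B \<and> g = (a + b) mod int \<omega>" if "g \<in> {0..<int \<omega>}" for g
    using assms that by (simp add: factorization_def carrier_integer_mod_group)
  have range: "(a + b) mod int \<omega> \<in> {0..<int \<omega>}" for a b
    using assms(1) by simp
  have "inj_on (\<lambda>(a, b). (a + b) mod int \<omega>) (A \<times> B)"
  proof (rule inj_onI, clarify)
    fix a b a' b'
    assume "a \<in> A" "b \<in> B" "a' \<in> A" "b' \<in> B" "(a + b) mod int \<omega> = (a' + b') mod int \<omega>"
    moreover have "\<exists>\<^sub>\<le>\<^sub>1(x, y). x \<in> A \<and> y \<in> B \<and> (a + b) mod int \<omega> = (x + y) mod int \<omega>"
      using ex1[OF range[of a b]] by (simp only: ex1_iff_ex_Uniq)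
    ultimately have "(a, b) = (a', b')"
      by (elim Uniq_D) simp_all
    then show "a = a' \<and> b = b'" by simp
  qed
  moreover have "(\<lambda>(a, b). (a + b) mod int \<omega>) ` (A \<times> B) = {0..<int \<omega>}"
  proof
    show "(\<lambda>(a, b). (a + b) mod int \<omega>) ` (A \<times> B) \<subseteq> {0..<int \<omega>}"
      using range by auto
    show "{0..<int \<omega>} \<subseteq> (\<lambda>(a, b). (a + b) mod int \<omega>) ` (A \<times> B)"
    proof
      fix g assume "g \<in> {0..<int \<omega>}"
      from ex1_implies_ex[OF ex1[OF this]] show "g \<in> (\<lambda>(a, b). (a + b) mod int \<omega>) ` (A \<times> B)"
        by auto
    qed
  qed
  ultimately show ?thesis by (simp add: bij_betw_def)
qed

text \<open>Write b + n = r + c modulo w with 0 \<le> r < n and c in \<open>B\<close>. If r > 0,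
  then (n - r) + b and 0 + c represent the same element, and both n - r and 0 lie in
  \<open>{0..<n}\<close>, so n - r = 0, which is absurd. Hence r = 0 and b + n is c;
  iterate.\<close>

lemma periodic_if_interval_tiling:
  fixes B :: "int set"
  assumes "w > 0" and B: "B \<subseteq> {0..<w}"
    and bij: "bij_betw (\<lambda>(r, b). (r + b) mod w) ({0..<n} \<times> B) {0..<w}" and "b \<in> B"
  shows "(b + int k * n) mod w \<in> B"
proof -
  have step: "(b + n) mod w \<in> B" if b: "b \<in> B" for b
  proof -
    have "(b + n) mod w \<in> (\<lambda>(r, b). (r + b) mod w) ` ({0..<n} \<times> B)"
      using bij \<open>w > 0\<close> by (simp add: bij_betw_def)
    then obtain r c where r: "0 \<le> r" "r < n" and c: "c \<in> B" and eq: "(b + n) mod w = (r + c) mod w"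
      by auto
    show ?thesis
    proof (cases "r = 0")
      case True
      then show ?thesis using eq B c by auto
    next
      case False
      have "(b + n - r) mod w = (r + c - r) mod w"
        using eq by (rule mod_diff_cong) simp
      then have "((n - r) + b) mod w = (0 + c) mod w"
        by (simp add: algebra_simps)
      then have "(n - r, b) = (0, c)"
        using inj_onD[OF bij_betw_imp_inj_on[OF bij], of "(n - r, b)" "(0, c)"] r c b False
        by simp
      then show ?thesis using r by simp
    qed
  qed
  show ?thesis
  proof (induction k)
    case 0
    then show ?case using B \<open>b \<in> B\<close> by auto
  next
    case (Suc k)
    have "((b + int k * n) mod w + n) mod w = (b + int (Suc k) * n) mod w"
      unfolding mod_add_left_eq by (simp add: algebra_simps)
    with step[OF Suc] show ?case by simp
  qed
qed

theorem theorem10: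
  fixes \<omega> n :: nat and i j :: int and A :: "int set"
  assumes "\<omega> > 0" and "n \<ge> 5"
    and "i \<in> carrier (integer_mod_group \<omega>)" and "j \<in> carrier (integer_mod_group \<omega>)"
    and "A = interval_mod \<omega> 0 (int n - 3) \<union> {i, j}"
    and "card A = n"
    and "direct_factor (integer_mod_group \<omega>) A"
  shows "set_cong n {i, j} {int n - 2, int n - 1}"
proof -
  define w N where "w = int \<omega>" and "N = int n"
  have w: "w > 0" and N: "N \<ge> 5" using assms(1,2) by (auto simp: w_def N_def)
  obtain B where fact: "factorization (integer_mod_group \<omega>) A B"
    using assms(7) by (auto simp: direct_factor_def)
  then have AB: "A \<subseteq> {0..<w}" "B \<subseteq> {0..<w}" "B \<noteq> {}"
    using assms(1) by (auto simp: factorization_def carrier_integer_mod_group w_def)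
  have fin: "finite A" "finite B" using AB finite_subset by blast+
  \<comment> \<open>With N \<le> w, reduction modulo w fixes every element of [0, N - 3].\<close>
  have "N \<le> w"
    using card_mono[OF _ AB(1)] assms(6) by (simp add: N_def w_def)
  then have A: "A = {0..N - 3} \<union> {i, j}"
    using assms(5) by (force simp: interval_mod_def N_def w_def)
  have bij: "bij_betw (\<lambda>(a, b). (a + b) mod w) (A \<times> B) {0..<w}"
    using bij_betw_factorization[OF assms(1) fact] by (simp add: w_def)
  have unique: "a = a'"
    if "(a + b) mod w = (a' + b') mod w" "a \<in> A" "a' \<in> A" "b \<in> B" "b' \<in> B" for a a' b b'
    using inj_onD[OF bij_betw_imp_inj_on[OF bij], of "(a, b)" "(a', b')"] that by simp
  have card_AB: "n * card B = \<omega>"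
    using bij_betw_same_card[OF bij] assms(6) by (simp add: card_cartesian_product w_def)

  \<comment> \<open>This is where n \<ge> 5 enters: 2 \<le> N - 3 puts d and 0 in \<open>A\<close>,
    and cancelling a leaves d + b = 0 + b', two representations of one element.\<close>
  have same_translate: False
    if "x mod w = (a + b) mod w" "(x + d) mod w = (a + b') mod w" "b \<in> B" "b' \<in> B" "d = 1 \<or> d = 2"
    for x d a b b'
  proof -
    have "((x + d) - x) mod w = ((a + b') - (a + b)) mod w"
      using that(2,1) by (rule mod_diff_cong)
    then have "(d + b) mod w = ((b' - b) + b) mod w"
      by (intro mod_add_cong) auto
    then have "d = 0"
      using unique[of d b 0 b'] that N by (auto simp: A)
    then show False using that by simp
  qed
  have cover: "\<exists>r\<in>{0..<N}. \<exists>b\<in>B. x mod w = (r + b) mod w" for x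
  proof -
    have ex: "\<exists>a\<in>A. \<exists>b\<in>B. y mod w = (a + b) mod w" for y
    proof -
      have "y mod w \<in> (\<lambda>(a, b). (a + b) mod w) ` (A \<times> B)"
        using bij w by (simp add: bij_betw_def)
      then show ?thesis by auto
    qed
    \<comment> \<open>A shift by at most 2 keeps a + d within [0, N - 1].\<close>
    have shift: ?thesis if "d \<in> {0..2}" "a \<in> {0..N - 3}" "b \<in> B" "(x - d) mod w = (a + b) mod w" for d a b
    proof (intro bexI)
      have "((x - d) + d) mod w = ((a + b) + d) mod w"
        using that(4) by (intro mod_add_cong) auto
      then show "x mod w = ((a + d) + b) mod w" by (simp add: algebra_simps)
    qed (use that in auto)
    obtain a0 b0 where 0: "a0 \<in> A" "b0 \<in> B" "(x - 2) mod w = (a0 + b0) mod w" using ex by blast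
    obtain a1 b1 where 1: "a1 \<in> A" "b1 \<in> B" "(x - 1) mod w = (a1 + b1) mod w" using ex by blast
    obtain a2 b2 where 2: "a2 \<in> A" "b2 \<in> B" "x mod w = (a2 + b2) mod w" using ex by blast
    \<comment> \<open>Three pairwise distinct elements of \<open>A\<close> cannot all lie in {i,
      j}.\<close>
    have "a0 \<noteq> a1" using same_translate[of "x - 2" a0 b0 1 b1] 0 1 by auto
    moreover have "a1 \<noteq> a2" using same_translate[of "x - 1" a1 b1 1 b2] 1 2 by auto
    moreover have "a0 \<noteq> a2" using same_translate[of "x - 2" a0 b0 2 b2] 0 2 by auto
    ultimately have "a0 \<in> {0..N - 3} \<or> a1 \<in> {0..N - 3} \<or> a2 \<in> {0..N - 3}"
      using 0(1) 1(1) 2(1) unfolding A by blast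
    then show ?thesis
      using shift[of 2 a0 b0] shift[of 1 a1 b1] shift[of 0 a2 b2] 0 1 2 by auto
  qed
  let ?f = "\<lambda>(r, b). (r + b) mod w"
  have image: "?f ` ({0..<N} \<times> B) = {0..<w}"
  proof
    show "?f ` ({0..<N} \<times> B) \<subseteq> {0..<w}" using w by auto
    show "{0..<w} \<subseteq> ?f ` ({0..<N} \<times> B)"
    proof
      fix x assume "x \<in> {0..<w}"
      with cover[of x] show "x \<in> ?f ` ({0..<N} \<times> B)" by force
    qed
  qed
  \<comment> \<open>The domain has N |B| = \<omega> elements, as many as the image, so surjectivity
    gives injectivity.\<close>
  have "inj_on ?f ({0..<N} \<times> B)"
    by (rule eq_card_imp_inj_on)
      (use image fin card_AB in \<open>auto simp: card_cartesian_product N_def w_def\<close>)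
  with image have tiling: "bij_betw ?f ({0..<N} \<times> B) {0..<w}"
    by (simp add: bij_betw_def)

  \<comment> \<open>With a = a' + k N, the sum a + b equals a' + (b + k N), whose second summand is
    again in \<open>B\<close> by periodicity. The order a' \<le> a makes k a natural number.\<close>
  have cong_eq: "a = a'" if mem: "a \<in> A" "a' \<in> A" and cong: "a mod N = a' mod N" and le: "a' \<le> a" for a a'
  proof -
    obtain b where b: "b \<in> B" using AB by blast
    obtain q where q: "a - a' = N * q" using cong by (auto simp: mod_eq_dvd_iff)
    have "0 \<le> N * q" using le by (simp flip: q)
    then have "0 \<le> q" using N by (simp add: zero_le_mult_iff)
    then obtain k where "q = int k" by (rule nonneg_int_cases)
    then have a: "a = a' + int k * N" using q by (simp add: algebra_simps)
    have "(b + int k * N) mod w \<in> B"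
      using w AB(2) tiling b by (rule periodic_if_interval_tiling)
    moreover have "(a + b) mod w = (a' + (b + int k * N) mod w) mod w"
      by (subst a) (simp add: mod_add_right_eq algebra_simps)
    ultimately show ?thesis using unique mem b by blast
  qed
  then have inj_mod: "inj_on (\<lambda>a. a mod N) A"
    by (metis inj_onI linear)
  \<comment> \<open>The n elements of \<open>A\<close> have distinct residues, so every residue
    occurs.\<close>
  have "(\<lambda>a. a mod N) ` A = {0..<N}"
    by (rule card_subset_eq) (use N inj_mod assms(6) in \<open>auto simp: card_image N_def\<close>)
  \<comment> \<open>An overlap would leave at most (N - 2) + 1 elements in \<open>A\<close>.\<close>
  moreover have disj: "{0..N - 3} \<inter> {i, j} = {}"
  proof (rule ccontr)
    assume "{0..N - 3} \<inter> {i, j} \<noteq> {}"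
    then have "A = insert i {0..N - 3} \<or> A = insert j {0..N - 3}" unfolding A by blast
    then have "card A \<le> Suc (card {0..N - 3})" by (auto simp: card_insert_if)
    then show False using assms(6) N by (simp add: N_def)
  qed
  moreover have "(\<lambda>a. a mod N) ` {0..N - 3} = {0..N - 3}"
    using N by (force simp: image_iff)
  \<comment> \<open>By injectivity i and j avoid the residues of the interval, so exactly N - 2 and
    N - 1 remain for them.\<close>
  moreover have "(\<lambda>a. a mod N) ` {0..N - 3} \<inter> (\<lambda>a. a mod N) ` {i, j} = {}"
    using disj by (subst inj_on_image_Int[OF inj_mod, symmetric]) (auto simp: A)
  ultimately have "(\<lambda>a. a mod N) ` {i, j} = {0..<N} - {0..N - 3}"
    unfolding A image_Un by blast
  also have "\<dots> = {N - 2, N - 1}" using N by auto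
  also have "\<dots> = (\<lambda>a. a mod N) ` {N - 2, N - 1}"
    using N mod_pos_pos_trivial[of "N - 2" N] mod_pos_pos_trivial[of "N - 1" N]
    by (simp del: minus_mod_self2)
  finally show ?thesis by (simp add: set_cong_def N_def)
qed

end
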